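(* Let $\mathcal{L}$ be a finite multigraph that is 2-cell embedded in a closed orientable surface $\Sigma$ of genus $g$, let $N=|\mathbb{E}(\mathcal{L})|$, and let $|\mathbf{v}\rangle$ with $\mathbf{v}\in\{-1,1\}^{2g}$ be a surface code state on $\mathcal{L}$ (for this embedding). Let $\mathcal{L}'$ be any spanning tree of $\mathcal{L}$. Then the graph state $|\varphi_{\mathcal{L}'}(\mathcal{L})\rangle\in\bigotimes_{e\in\mathbb{E}(\mathcal{L})}\mathbb{C}^2$ is LC-equivalent to $|\mathbf{v}\rangle$.
   Context: Multigraphs are finite, undirected, may have multiple edges, and have no loops. $\mathbb{V}(\cdot)$ and $\mathbb{E}(\cdot)$ denote vertex and edge sets. A 2-cell embedding in $\Sigma$ is an embedding such that every face is homeomorphic to an open disc (so $\mathcal{L}$ is connected); $\mathbb{P}(\mathcal{L})$ is the set of faces. $\sigma^x_i,\sigma^y_i,\sigma^z_i$ are the Pauli matrices acting on qubit $i$. Surface code. One qubit is placed on each edge of $\mathcal{L}$. For a vertex $s$ put $A_s=\prod_{i\ni s}\sigma^x_i$ (product over the edges incident to $s$), and for a face $p$ put $B_p=\prod_{i\in p}\sigma^z_i$ (product over the edges on the boundary of $p$, where an edge traversed twice by the boundary walk of $p$ contributes trivially). A cycle is a set of edges $\mathcal{C}\subseteq\mathbb{E}(\mathcal{L})$ such that every vertex is incident to an even number of them; $Z[\mathcal{C}]=\prod_{i\in\mathcal{C}}\sigma^z_i$. Fix simple cycles $\mathcal{C}_1,\dots,\mathcal{C}_{2g}$ whose classes form a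 basis of the first homology group of $\Sigma$ with $\mathbb{F}_2$ coefficients, and let $Z_k=Z[\mathcal{C}_k]$. For $\mathbf{v}\in\{-1,1\}^{2g}$ the surface code state $|\mathbf{v}\rangle$ is the unit vector (unique up to phase) with $A_s|\mathbf{v}\rangle=|\mathbf{v}\rangle$ for all $s\in\mathbb{V}(\mathcal{L})$, $B_p|\mathbf{v}\rangle=|\mathbf{v}\rangle$ for all $p\in\mathbb{P}(\mathcal{L})$, and $Z_k|\mathbf{v}\rangle=v_k|\mathbf{v}\rangle$ for $1\le k\le 2g$. Graph state. For a simple graph $G$ with neighbourhoods $N_v$, qubits are identified with the vertices of $G$, and $|G\rangle$ is the state (unique up to phase) with $K_G^{v}|G\rangle=|G\rangle$ for all $v\in\mathbb{V}(G)$, where $K_G^v=\sigma^x_v\prod_{w\in N_v}\sigma^z_w$. The graph $\varphi_{\mathcal{L}'}(\mathcal{L})$. A spanning tree $\mathcal{L}'$ of $\mathcal{L}$ is a connected subgraph without cycles (in particular without multiple edges) with $\mathbb{V}(\mathcal{L}')=\mathbb{V}(\mathcal{L})$ and $\mathbb{E}(\mathcal{L}')\subseteq\mathbb{E}(\mathcal{L})$. The simple graph $G=\varphi_{\mathcal{L}'}(\mathcal{L})$ has vertex set $\mathbb{V}(G)=\mathbb{E}(\mathcal{L})$, and for distinct $r,s\in\mathbb{E}(\mathcal{L})$ the unordered pair $\{r,s\}$ is an edge of $G$ if and only if, for one of the two elements (call it $r$), with endpoints $p,q$ in $\mathcal{L}$, the other element $s$ lies on the unique path $\mathcal{C}_{pq}$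 in $\mathcal{L}'$ from $p$ to $q$. LC-equivalence. The Pauli group $G_1$ is the group generated by $\sigma^x,\sigma^y,\sigma^z$; the Clifford group is $C_1=\{U\in U(2): UG_1U^\dagger=G_1\}$; the local Clifford group is $C_N^l=\bigotimes_{i=1}^N C_1^{(i)}$. Two $N$-qubit states $|\Psi\rangle,|\Psi'\rangle$ are LC-equivalent if $|\Psi\rangle=C|\Psi'\rangle$ for some $C\in C_N^l$. *)

theory Defs
  imports "HOL-Analysis.Analysis" "HOL-Homology.Homology"
begin

section \<open>Multigraphs, cycles and spanning trees\<close>

record ('v, 'e) multigraph =
  verts :: "'v set"
  edges :: "'e set"
  ends :: "'e \<Rightarrow> 'v set"

definition multigraph :: "('v, 'e) multigraph \<Rightarrow> bool" where
  "multigraph L \<longleftrightarrow> finite (verts L) \<and> finite (edges L) \<and>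
     (\<forall>e \<in> edges L. ends L e \<subseteq> verts L \<and> card (ends L e) = 2)"

definition cycle :: "('v, 'e) multigraph \<Rightarrow> 'e set \<Rightarrow> bool" where
  "cycle L D \<longleftrightarrow> D \<subseteq> edges L \<and> (\<forall>x \<in> verts L. even (card {e \<in> D. x \<in> ends L e}))"

text \<open>In a loopless multigraph the condition below forces length at least 2;
  length 2 is a pair of parallel edges.\<close>

definition simple_cycle :: "('v, 'e) multigraph \<Rightarrow> 'e set \<Rightarrow> bool" where
  "simple_cycle L D \<longleftrightarrow> D \<subseteq> edges L \<and>
     (\<exists>xs es. es \<noteq> [] \<and> length xs = length es \<and> distinct xs \<and> distinct es \<and>
        set xs \<subseteq> verts L \<and> set es = D \<and>
        (\<forall>i < length es. ends L (es ! i) = {xs ! i, xs ! (Suc i mod length es)}))"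

definition graph_path :: "('v, 'e) multigraph \<Rightarrow> 'v \<Rightarrow> 'v list \<Rightarrow> 'e list \<Rightarrow> 'v \<Rightarrow> bool" where
  "graph_path L p xs es q \<longleftrightarrow>
     length xs = Suc (length es) \<and> distinct xs \<and> hd xs = p \<and> last xs = q \<and>
     set xs \<subseteq> verts L \<and> set es \<subseteq> edges L \<and>
     (\<forall>i < length es. ends L (es ! i) = {xs ! i, xs ! Suc i})"

definition connected_graph :: "('v, 'e) multigraph \<Rightarrow> bool" where
  "connected_graph L \<longleftrightarrow> (\<forall>p \<in> verts L. \<forall>q \<in> verts L. \<exists>xs es. graph_path L p xs es q)"

definition spanning_tree :: "('v, 'e) multigraph \<Rightarrow> ('v, 'e) multigraph \<Rightarrow> bool" where
  "spanning_tree T L \<longleftrightarrow>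
     verts T = verts L \<and> edges T \<subseteq> edges L \<and> (\<forall>e \<in> edges T. ends T e = ends L e) \<and>
     connected_graph T \<and> \<not> (\<exists>D. simple_cycle T D)"

text \<open>The edge set of the simple graph on the vertex set \<^term>\<open>edges L\<close>. The existentially
  quantified path is the only one from \<^term>\<open>p\<close> to \<^term>\<open>q\<close> when \<^term>\<open>T\<close> is a tree. As
  \<^term>\<open>{r, s}\<close> is unordered, either of its elements may play the role of \<^term>\<open>r\<close>.\<close>

definition phi_edges :: "('v, 'e) multigraph \<Rightarrow> ('v, 'e) multigraph \<Rightarrow> 'e set set" where
  "phi_edges T L = {{r, s} | r s. r \<in> edges L \<and> s \<in> edges L \<and> r \<noteq> s \<and>
     (\<exists>p q xs es. ends L r = {p, q} \<and> graph_path T p xs es q \<and> s \<in> set es)}"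


section \<open>Closed orientable surfaces and 2-cell embeddings\<close>

definition closed_surface :: "'a topology \<Rightarrow> bool" where
  "closed_surface X \<longleftrightarrow>
     topspace X \<noteq> {} \<and> compact_space X \<and> connected_space X \<and>
     Hausdorff_space X \<and> second_countable X \<and>
     (\<forall>x \<in> topspace X. \<exists>U. openin X U \<and> x \<in> U \<and>
        subtopology X U homeomorphic_space top_of_set (ball (0 :: real^2) 1))"

text \<open>An orientation is a choice of a generator of the local homology group
  $H_2(X, X - x)$ at every point $x$ that is locally induced by a single class
  in $H_2(X, X - U)$.\<close>

definition orientable_surface :: "'a topology \<Rightarrow> bool" where
  "orientable_surface X \<longleftrightarrow>
     (\<exists>\<mu>. (\<forall>x \<in> topspace X.
            \<mu> x \<in> carrier (relative_homology_group 2 X (topspace X - {x})) \<and>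
            generate (relative_homology_group 2 X (topspace X - {x})) {\<mu> x} =
              carrier (relative_homology_group 2 X (topspace X - {x}))) \<and>
          (\<forall>x \<in> topspace X. \<exists>U. openin X U \<and> x \<in> U \<and>
            (\<exists>\<alpha> \<in> carrier (relative_homology_group 2 X (topspace X - U)). \<forall>y \<in> U.
               hom_induced 2 X (topspace X - U) X (topspace X - {y}) id \<alpha> = \<mu> y)))"

text \<open>The genus is half of the first Betti number.\<close>

definition closed_orientable_surface :: "'a topology \<Rightarrow> nat \<Rightarrow> bool" where
  "closed_orientable_surface X g \<longleftrightarrow> closed_surface X \<and> orientable_surface X \<and>
     homology_group 1 X \<cong> free_Abelian_group {..<2 * g}"

definition graph_embedding ::
    "('v, 'e) multigraph \<Rightarrow> 'a topology \<Rightarrow> ('v \<Rightarrow> 'a) \<Rightarrow> ('e \<Rightarrow> real \<Rightarrow> 'a) \<Rightarrow> bool" where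
  "graph_embedding L X pt crv \<longleftrightarrow>
     pt ` verts L \<subseteq> topspace X \<and> inj_on pt (verts L) \<and>
     (\<forall>e \<in> edges L. embedding_map (top_of_set {0..1}) X (crv e) \<and>
        {crv e 0, crv e 1} = pt ` ends L e \<and>
        crv e ` {0<..<1} \<inter> pt ` verts L = {}) \<and>
     (\<forall>e \<in> edges L. \<forall>f \<in> edges L. e \<noteq> f \<longrightarrow> crv e ` {0<..<1} \<inter> crv f ` {0<..<1} = {})"

definition graph_image ::
    "('v, 'e) multigraph \<Rightarrow> ('v \<Rightarrow> 'a) \<Rightarrow> ('e \<Rightarrow> real \<Rightarrow> 'a) \<Rightarrow> 'a set" where
  "graph_image L pt crv = pt ` verts L \<union> (\<Union>e \<in> edges L. crv e ` {0..1})"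

definition faces ::
    "('v, 'e) multigraph \<Rightarrow> 'a topology \<Rightarrow> ('v \<Rightarrow> 'a) \<Rightarrow> ('e \<Rightarrow> real \<Rightarrow> 'a) \<Rightarrow> 'a set set" where
  "faces L X pt crv =
     connected_components_of (subtopology X (topspace X - graph_image L pt crv))"

definition two_cell_embedding ::
    "('v, 'e) multigraph \<Rightarrow> 'a topology \<Rightarrow> ('v \<Rightarrow> 'a) \<Rightarrow> ('e \<Rightarrow> real \<Rightarrow> 'a) \<Rightarrow> bool" where
  "two_cell_embedding L X pt crv \<longleftrightarrow> graph_embedding L X pt crv \<and>
     (\<forall>p \<in> faces L X pt crv.
        subtopology X p homeomorphic_space top_of_set (ball (0 :: real^2) 1))"

text \<open>The edges that the boundary walk of the face \<^term>\<open>p\<close> traverses exactly once. An edge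
  has two sides, each of which belongs to one face. The walk traverses the edge once per side
  that belongs to \<^term>\<open>p\<close>, so exactly once iff the edge lies on the boundary of \<^term>\<open>p\<close>
  and on that of a second face.\<close>

definition face_boundary ::
    "('v, 'e) multigraph \<Rightarrow> 'a topology \<Rightarrow> ('v \<Rightarrow> 'a) \<Rightarrow> ('e \<Rightarrow> real \<Rightarrow> 'a) \<Rightarrow> 'a set \<Rightarrow> 'e set" where
  "face_boundary L X pt crv p =
     {e \<in> edges L. crv e ` {0..1} \<subseteq> X frontier_of p \<and>
        (\<exists>p' \<in> faces L X pt crv. p' \<noteq> p \<and> crv e ` {0..1} \<subseteq> X frontier_of p')}"


section \<open>First homology with coefficients in the field of two elements\<close>

text \<open>A chain over the field of two elements is identified with its support, and
  \<^term>\<open>sum_mod2\<close> is the sum of a finite family of such chains.\<close>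

definition sum_mod2 :: "'i set \<Rightarrow> ('i \<Rightarrow> 'e set) \<Rightarrow> 'e set" where
  "sum_mod2 I A = {e. odd (card {i \<in> I. e \<in> A i})}"

text \<open>A 2-cell embedding makes the surface a CW complex with the vertices, edges and faces as
  cells, and its homology is taken to be the cellular one: 1-cycles (\<^term>\<open>cycle\<close>)
  modulo boundaries of 2-chains.\<close>

definition homologous ::
    "('v, 'e) multigraph \<Rightarrow> 'a topology \<Rightarrow> ('v \<Rightarrow> 'a) \<Rightarrow> ('e \<Rightarrow> real \<Rightarrow> 'a) \<Rightarrow>
     'e set \<Rightarrow> 'e set \<Rightarrow> bool" where
  "homologous L X pt crv D D' \<longleftrightarrow>
     (\<exists>F. finite F \<and> F \<subseteq> faces L X pt crv \<and>
        sym_diff D D' = sum_mod2 F (face_boundary L X pt crv))"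

text \<open>The classes of a family form a basis iff every class is a unique combination of them;
  over the field of two elements a combination is given by a subset of the index set.\<close>

definition simple_homology_basis ::
    "('v, 'e) multigraph \<Rightarrow> 'a topology \<Rightarrow> ('v \<Rightarrow> 'a) \<Rightarrow> ('e \<Rightarrow> real \<Rightarrow> 'a) \<Rightarrow>
     nat \<Rightarrow> (nat \<Rightarrow> 'e set) \<Rightarrow> bool" where
  "simple_homology_basis L X pt crv n C \<longleftrightarrow>
     (\<forall>k \<in> {1..n}. simple_cycle L (C k)) \<and>
     (\<forall>D. cycle L D \<longrightarrow>
        (\<exists>!K. K \<subseteq> {1..n} \<and> homologous L X pt crv D (sum_mod2 K C)))"


section \<open>Qubits\<close>

text \<open>The computational basis of a qubit is indexed by \<^typ>\<open>bool\<close>, with \<^term>\<open>False\<close> for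
  $|0\rangle$ and \<^term>\<open>True\<close> for $|1\rangle$. A vector in the tensor product of one qubit per
  element of \<^term>\<open>E\<close> is given by its amplitudes; the basis state \<^term>\<open>S\<close>, a subset
  of \<^term>\<open>E\<close>, has exactly the qubits in \<^term>\<open>S\<close> in state $|1\rangle$.\<close>

type_synonym gate = "complex^bool^bool"
type_synonym 'e qvec = "'e set \<Rightarrow> complex"

definition unit_qvec :: "'e set \<Rightarrow> 'e qvec \<Rightarrow> bool" where
  "unit_qvec E \<psi> \<longleftrightarrow> (\<forall>S. \<not> S \<subseteq> E \<longrightarrow> \<psi> S = 0) \<and> (\<Sum>S \<in> Pow E. (cmod (\<psi> S))\<^sup>2) = 1"

definition tensor_op :: "'e set \<Rightarrow> ('e \<Rightarrow> gate) \<Rightarrow> 'e qvec \<Rightarrow> 'e qvec" where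
  "tensor_op E U \<psi> = (\<lambda>S. if S \<subseteq> E
     then \<Sum>R \<in> Pow E. (\<Prod>i \<in> E. U i $ (i \<in> S) $ (i \<in> R)) * \<psi> R else 0)"

definition pauli_x :: gate where
  "pauli_x = (\<chi> a b. if a = b then 0 else 1)"

definition pauli_y :: gate where
  "pauli_y = (\<chi> a b. if a = b then 0 else if a then \<i> else - \<i>)"

definition pauli_z :: gate where
  "pauli_z = (\<chi> a b. if a \<noteq> b then 0 else if a then - 1 else 1)"

definition x_op :: "'e set \<Rightarrow> 'e set \<Rightarrow> 'e qvec \<Rightarrow> 'e qvec" where
  "x_op E A = tensor_op E (\<lambda>i. if i \<in> A then pauli_x else mat 1)"

definition z_op :: "'e set \<Rightarrow> 'e set \<Rightarrow> 'e qvec \<Rightarrow> 'e qvec" where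
  "z_op E A = tensor_op E (\<lambda>i. if i \<in> A then pauli_z else mat 1)"

definition surface_code_state ::
    "('v, 'e) multigraph \<Rightarrow> 'a topology \<Rightarrow> ('v \<Rightarrow> 'a) \<Rightarrow> ('e \<Rightarrow> real \<Rightarrow> 'a) \<Rightarrow>
     nat \<Rightarrow> (nat \<Rightarrow> 'e set) \<Rightarrow> (nat \<Rightarrow> int) \<Rightarrow> 'e qvec \<Rightarrow> bool" where
  "surface_code_state L X pt crv n C v \<psi> \<longleftrightarrow>
     unit_qvec (edges L) \<psi> \<and>
     (\<forall>s \<in> verts L. x_op (edges L) {e \<in> edges L. s \<in> ends L e} \<psi> = \<psi>) \<and>
     (\<forall>p \<in> faces L X pt crv. z_op (edges L) (face_boundary L X pt crv p) \<psi> = \<psi>) \<and>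
     (\<forall>k \<in> {1..n}. z_op (edges L) (C k) \<psi> = (\<lambda>S. of_int (v k) * \<psi> S))"

text \<open>The graph state of the simple graph with vertex set \<^term>\<open>E\<close> and edge set \<^term>\<open>H\<close>.\<close>

definition graph_state :: "'e set \<Rightarrow> 'e set set \<Rightarrow> 'e qvec \<Rightarrow> bool" where
  "graph_state E H \<psi> \<longleftrightarrow> unit_qvec E \<psi> \<and>
     (\<forall>a \<in> E. x_op E {a} (z_op E {b \<in> E. {a, b} \<in> H} \<psi>) = \<psi>)"


section \<open>Local Clifford equivalence\<close>

definition adjoint_gate :: "gate \<Rightarrow> gate" where
  "adjoint_gate U = (\<chi> a b. cnj (U $ b $ a))"

text \<open>The generators are involutions, so closure under products yields the generated group.\<close>

inductive_set pauli_group :: "gate set" where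
  one: "mat 1 \<in> pauli_group"
| x: "pauli_x \<in> pauli_group"
| y: "pauli_y \<in> pauli_group"
| z: "pauli_z \<in> pauli_group"
| mult: "P \<in> pauli_group \<Longrightarrow> Q \<in> pauli_group \<Longrightarrow> P ** Q \<in> pauli_group"

definition clifford_group :: "gate set" where
  "clifford_group = {U. U ** adjoint_gate U = mat 1 \<and> adjoint_gate U ** U = mat 1 \<and>
     (\<lambda>P. U ** P ** adjoint_gate U) ` pauli_group = pauli_group}"

text \<open>States are determined up to a phase. The factor \<^term>\<open>c\<close> can be absorbed into one of
  the gates and matters only if there are no qubits at all.\<close>

definition lc_equivalent :: "'e set \<Rightarrow> 'e qvec \<Rightarrow> 'e qvec \<Rightarrow> bool" where
  "lc_equivalent E \<psi> \<psi>' \<longleftrightarrow>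
     (\<exists>U c. (\<forall>i \<in> E. U i \<in> clifford_group) \<and> cmod c = 1 \<and>
        \<psi> = (\<lambda>S. c * tensor_op E U \<psi>' S))"

end

theory Submission
  imports Defs
begin

text \<open>Only the mod 2 cellular structure of the embedding matters. Every cycle is a sum of face boundaries
  and basis cycles, so the surface code state is an eigenvector of \<open>Z[D]\<close> for all cycles \<open>D\<close>. For an
  edge \<open>f\<close> outside the tree take its fundamental cycle, for a tree edge \<open>e\<close> its fundamental cut: the
  product of the vertex operators on one side of the cut is the \<open>\<sigma>\<^sup>x\<close> product over the cut.
  Applying \<open>\<sigma>\<^sup>x\<close> to the edges outside the tree whose cycle has eigenvalue \<open>-1\<close> makes all eigenvalues
  \<open>1\<close>; Hadamard gates on the edges outside the tree then turn these stabilizers into those of the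
  graph state, because \<open>e\<close> lies on the cycle of \<open>f\<close> iff \<open>f\<close> lies on the cut of \<open>e\<close>.\<close>

section \<open>Tensor products of gates\<close>

lemma tensor_op_cong:
  assumes "\<And>i. i \<in> E \<Longrightarrow> U i = V i"
  shows "tensor_op E U \<psi> = tensor_op E V \<psi>"
  unfolding tensor_op_def
  using assms by (intro ext if_cong sum.cong refl arg_cong2[where f = times] prod.cong) auto

text \<open>Expanding the product picks \<open>True\<close> or \<open>False\<close> for every
  \<open>i\<close>; a choice is the subset \<open>R\<close> of the indices that get
  \<open>True\<close>.\<close>

lemma sum_Pow_prod:
  fixes f :: "'e \<Rightarrow> bool \<Rightarrow> 'a::comm_semiring_1"
  assumes "finite E"
  shows "(\<Sum>R\<in>Pow E. \<Prod>i\<in>E. f i (i \<in> R)) = (\<Prod>i\<in>E. \<Sum>b\<in>UNIV. f i b)"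
proof -
  have "(\<Prod>i\<in>E. \<Sum>b\<in>UNIV. f i b) = (\<Prod>i\<in>E. f i True + f i False)"
    by (simp add: UNIV_bool add.commute)
  also have "\<dots> = (\<Sum>R\<in>Pow E. (\<Prod>i\<in>R. f i True) * (\<Prod>i\<in>E - R. f i False))"
    by (rule prod_add[OF assms])
  also have "\<dots> = (\<Sum>R\<in>Pow E. \<Prod>i\<in>E. f i (i \<in> R))"
  proof (intro sum.cong refl)
    fix R assume "R \<in> Pow E"
    then have "(\<Prod>i\<in>E. f i (i \<in> R)) = (\<Prod>i\<in>E - R. f i (i \<in> R)) * (\<Prod>i\<in>R. f i (i \<in> R))"
      using assms by (intro prod.subset_diff) auto
    then show "(\<Prod>i\<in>R. f i True) * (\<Prod>i\<in>E - R. f i False) = (\<Prod>i\<in>E. f i (i \<in> R))"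
      by (simp add: mult.commute)
  qed
  finally show ?thesis ..
qed

text \<open>The sum over the intermediate basis states \<open>R\<close> factors qubit by qubit
  through \<open>sum_Pow_prod\<close>, leaving one matrix product per qubit.\<close>

lemma tensor_op_compose:
  assumes "finite E"
  shows "tensor_op E U (tensor_op E V \<psi>) = tensor_op E (\<lambda>i. U i ** V i) \<psi>"
proof
  fix S
  show "tensor_op E U (tensor_op E V \<psi>) S = tensor_op E (\<lambda>i. U i ** V i) \<psi> S"
  proof (cases "S \<subseteq> E")
    case True
    have "tensor_op E U (tensor_op E V \<psi>) S =
        (\<Sum>R\<in>Pow E. (\<Prod>i\<in>E. U i $ (i \<in> S) $ (i \<in> R)) *
          (\<Sum>Q\<in>Pow E. (\<Prod>i\<in>E. V i $ (i \<in> R) $ (i \<in> Q)) * \<psi> Q))"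
      using True by (simp add: tensor_op_def cong: sum.cong_simp)
    also have "\<dots> = (\<Sum>R\<in>Pow E. \<Sum>Q\<in>Pow E.
        (\<Prod>i\<in>E. U i $ (i \<in> S) $ (i \<in> R) * V i $ (i \<in> R) $ (i \<in> Q)) * \<psi> Q)"
      by (simp add: sum_distrib_left prod.distrib mult.assoc)
    also have "\<dots> = (\<Sum>Q\<in>Pow E. (\<Sum>R\<in>Pow E.
        \<Prod>i\<in>E. U i $ (i \<in> S) $ (i \<in> R) * V i $ (i \<in> R) $ (i \<in> Q)) * \<psi> Q)"
      by (subst sum.swap) (simp add: sum_distrib_right)
    also have "\<dots> = (\<Sum>Q\<in>Pow E. (\<Prod>i\<in>E. (U i ** V i) $ (i \<in> S) $ (i \<in> Q)) * \<psi> Q)"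
      by (subst sum_Pow_prod[OF assms, where f = "\<lambda>i b. U i $ (i \<in> S) $ b * V i $ b $ (i \<in> _)"])
        (simp add: matrix_matrix_mult_def)
    finally show ?thesis
      using True by (simp add: tensor_op_def)
  qed (simp add: tensor_op_def)
qed

lemma tensor_op_adjoint:
  "(\<Sum>S\<in>Pow E. cnj (\<omega> S) * tensor_op E U \<psi> S) =
    (\<Sum>S\<in>Pow E. cnj (tensor_op E (\<lambda>i. adjoint_gate (U i)) \<omega> S) * \<psi> S)"
proof -
  have "(\<Sum>S\<in>Pow E. cnj (\<omega> S) * tensor_op E U \<psi> S) =
      (\<Sum>S\<in>Pow E. \<Sum>R\<in>Pow E. cnj (\<omega> S) * ((\<Prod>i\<in>E. U i $ (i \<in> S) $ (i \<in> R)) * \<psi> R))"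
    by (simp add: tensor_op_def sum_distrib_left)
  also have "\<dots> = (\<Sum>R\<in>Pow E. \<Sum>S\<in>Pow E. cnj (\<omega> S) * ((\<Prod>i\<in>E. U i $ (i \<in> S) $ (i \<in> R)) * \<psi> R))"
    by (rule sum.swap)
  also have "\<dots> = (\<Sum>S\<in>Pow E. cnj (tensor_op E (\<lambda>i. adjoint_gate (U i)) \<omega> S) * \<psi> S)"
    by (simp add: tensor_op_def adjoint_gate_def sum_distrib_right sum_distrib_left ac_simps)
  finally show ?thesis .
qed

lemma tensor_op_id:
  assumes "finite E" "\<And>S. \<not> S \<subseteq> E \<Longrightarrow> \<psi> S = 0"
  shows "tensor_op E (\<lambda>i. mat 1) \<psi> = \<psi>"
proof
  fix S
  have *: "(\<Prod>i\<in>E. (mat 1 :: gate) $ (i \<in> S) $ (i \<in> R)) = (if R = S then 1 else 0)"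
    if sub: "S \<subseteq> E" "R \<in> Pow E" for R
  proof (cases "R = S")
    case False
    then obtain i where "i \<in> E" "(i \<in> S) \<noteq> (i \<in> R)"
      using sub by blast
    then have "(\<Prod>i\<in>E. (mat 1 :: gate) $ (i \<in> S) $ (i \<in> R)) = 0"
      using assms(1) by (intro prod_zero) (auto simp: mat_def)
    with False show ?thesis by simp
  qed (simp add: mat_def)
  show "tensor_op E (\<lambda>i. mat 1) \<psi> S = \<psi> S"
    using assms by (auto simp: tensor_op_def * if_distrib[of "\<lambda>x. x * _"] cong: if_cong)
qed

lemma x_op_empty:
  assumes "finite E" "unit_qvec E \<psi>"
  shows "x_op E {} \<psi> = \<psi>"
  using assms tensor_op_id[of E \<psi>] by (simp add: x_op_def unit_qvec_def)

lemma z_op_empty: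
  assumes "finite E" "unit_qvec E \<psi>"
  shows "z_op E {} \<psi> = \<psi>"
  using assms tensor_op_id[of E \<psi>] by (simp add: z_op_def unit_qvec_def)

text \<open>Moving \<open>U\<close> across the inner product by \<open>tensor_op_adjoint\<close>
  cancels it against its adjoint, so the norm is preserved.\<close>

lemma unit_qvec_tensor_op:
  assumes "finite E" "unit_qvec E \<psi>"
    and "\<And>i. i \<in> E \<Longrightarrow> adjoint_gate (U i) ** U i = mat 1"
  shows "unit_qvec E (tensor_op E U \<psi>)"
proof -
  have norm: "(\<Sum>S\<in>Pow E. cnj (\<omega> S) * \<omega> S) = of_real (\<Sum>S\<in>Pow E. (cmod (\<omega> S))\<^sup>2)" for \<omega>
    by (simp add: complex_norm_square mult.commute del: of_real_power)
  have "tensor_op E (\<lambda>i. adjoint_gate (U i)) (tensor_op E U \<psi>) = \<psi>"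
  proof -
    have "tensor_op E (\<lambda>i. adjoint_gate (U i) ** U i) \<psi> = tensor_op E (\<lambda>i. mat 1) \<psi>"
      by (rule tensor_op_cong) (rule assms(3))
    also have "\<dots> = \<psi>"
      using assms(1,2) by (intro tensor_op_id) (auto simp: unit_qvec_def)
    finally show ?thesis
      by (simp only: tensor_op_compose[OF assms(1)])
  qed
  then have "(\<Sum>S\<in>Pow E. (cmod (tensor_op E U \<psi> S))\<^sup>2) = (\<Sum>S\<in>Pow E. (cmod (\<psi> S))\<^sup>2)"
    using tensor_op_adjoint[of "tensor_op E U \<psi>" E U \<psi>]
    by (simp only: norm of_real_eq_iff)
  then show ?thesis
    using assms(2) by (simp add: unit_qvec_def tensor_op_def)
qed

section \<open>Products of Pauli matrices on sets of qubits\<close>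

lemma gate_mult_entry:
  fixes U V :: gate
  shows "(U ** V) $ a $ b = U $ a $ False * V $ False $ b + U $ a $ True * V $ True $ b"
  by (simp add: matrix_matrix_mult_def UNIV_bool)

lemma gate_eq_iff:
  fixes U V :: gate
  shows "U = V \<longleftrightarrow> U $ False $ False = V $ False $ False \<and> U $ False $ True = V $ False $ True \<and>
    U $ True $ False = V $ True $ False \<and> U $ True $ True = V $ True $ True"
  by (auto simp: vec_eq_iff all_bool_eq)

lemma pauli_x_involution: "pauli_x ** pauli_x = mat 1"
  and pauli_z_involution: "pauli_z ** pauli_z = mat 1"
  by (simp_all add: gate_eq_iff gate_mult_entry pauli_x_def pauli_z_def mat_def)

lemma x_op_sym_diff:
  assumes "finite E"
  shows "x_op E A (x_op E B \<psi>) = x_op E (sym_diff A B) \<psi>"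
  unfolding x_op_def tensor_op_compose[OF assms]
  by (rule tensor_op_cong) (auto simp: pauli_x_involution)

lemma z_op_sym_diff:
  assumes "finite E"
  shows "z_op E A (z_op E B \<psi>) = z_op E (sym_diff A B) \<psi>"
  unfolding z_op_def tensor_op_compose[OF assms]
  by (rule tensor_op_cong) (auto simp: pauli_z_involution)

lemma x_op_commute:
  assumes "finite E"
  shows "x_op E A (x_op E B \<psi>) = x_op E B (x_op E A \<psi>)"
  by (simp add: x_op_sym_diff[OF assms] Un_commute)

lemma tensor_op_scale: "tensor_op E U (\<lambda>S. c * \<psi> S) = (\<lambda>S. c * tensor_op E U \<psi> S)"
  by (auto simp: tensor_op_def sum_distrib_left ac_simps fun_eq_iff)

lemma x_op_amplitude:
  assumes "finite E" "A \<subseteq> E" "S \<subseteq> E"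
  shows "x_op E A \<psi> S = \<psi> (sym_diff S A)"
proof -
  let ?U = "\<lambda>i. if i \<in> A then pauli_x else mat 1"
  have *: "(\<Prod>i\<in>E. ?U i $ (i \<in> S) $ (i \<in> R)) = (if R = sym_diff S A then 1 else 0)"
    if sub: "R \<in> Pow E" for R
  proof (cases "R = sym_diff S A")
    case True
    then have "(\<Prod>i\<in>E. ?U i $ (i \<in> S) $ (i \<in> R)) = 1"
      by (intro prod.neutral) (auto simp: mat_def pauli_x_def)
    with True show ?thesis by simp
  next
    case False
    then obtain i where "i \<in> E" "(i \<in> R) \<noteq> (i \<in> sym_diff S A)"
      using sub assms by blast
    then have "(\<Prod>i\<in>E. ?U i $ (i \<in> S) $ (i \<in> R)) = 0"
      using assms(1) by (intro prod_zero bexI[of _ i]) (auto simp: mat_def pauli_x_def)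
    with False show ?thesis by simp
  qed
  have "sym_diff S A \<in> Pow E" using assms by auto
  then show ?thesis
    using assms by (simp add: x_op_def tensor_op_def * if_distrib[of "\<lambda>x. x * _"] cong: if_cong)
qed

text \<open>The sign is kept as a product over \<open>E\<close>, not as a power of
  \<open>- 1\<close>, so that signs can be multiplied factor by factor.\<close>

lemma z_op_amplitude:
  assumes "finite E" "S \<subseteq> E"
  shows "z_op E A \<psi> S = (\<Prod>i\<in>E. if i \<in> A \<inter> S then - 1 else 1) * \<psi> S"
proof -
  let ?U = "\<lambda>i. if i \<in> A then pauli_z else mat 1"
  have *: "(\<Prod>i\<in>E. ?U i $ (i \<in> S) $ (i \<in> R)) =
      (if R = S then \<Prod>i\<in>E. if i \<in> A \<inter> S then - 1 else 1 else 0)"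
    if sub: "R \<in> Pow E" for R
  proof (cases "R = S")
    case True
    then show ?thesis
      by (auto intro!: prod.cong simp: mat_def pauli_z_def)
  next
    case False
    then obtain i where "i \<in> E" "(i \<in> R) \<noteq> (i \<in> S)"
      using sub assms by blast
    then have "(\<Prod>i\<in>E. ?U i $ (i \<in> S) $ (i \<in> R)) = 0"
      using assms(1) by (intro prod_zero bexI[of _ i]) (auto simp: mat_def pauli_z_def)
    with False show ?thesis by simp
  qed
  show ?thesis
    using assms by (simp add: z_op_def tensor_op_def * if_distrib[of "\<lambda>x. x * _"] cong: if_cong)
qed

text \<open>\<open>pauli_x\<close> and \<open>pauli_z\<close> anticommute, which costs one sign for
  each qubit in \<open>A \<inter> B\<close>.\<close>

lemma z_op_x_op:
  assumes "finite E" "A \<subseteq> E"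
  shows "z_op E B (x_op E A \<psi>) = (\<lambda>S. (\<Prod>i\<in>E. if i \<in> A \<inter> B then - 1 else 1) * x_op E A (z_op E B \<psi>) S)"
proof
  fix S
  show "z_op E B (x_op E A \<psi>) S = (\<Prod>i\<in>E. if i \<in> A \<inter> B then - 1 else 1) * x_op E A (z_op E B \<psi>) S"
  proof (cases "S \<subseteq> E")
    case True
    \<comment> \<open>Passing from \<open>S\<close> to \<open>sym_diff S A\<close> changes
      membership exactly on \<open>A\<close>, so the two phase signs differ exactly on
      \<open>A \<inter> B\<close>.\<close>
    have "(\<Prod>i\<in>E. if i \<in> B \<inter> S then - 1 else 1 :: complex) =
        (\<Prod>i\<in>E. if i \<in> A \<inter> B then - 1 else 1) * (\<Prod>i\<in>E. if i \<in> B \<inter> sym_diff S A then - 1 else 1)"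
      unfolding prod.distrib[symmetric] by (rule prod.cong) auto
    moreover have "sym_diff S A \<subseteq> E" using True assms by auto
    ultimately show ?thesis
      using assms True by (simp only: z_op_amplitude x_op_amplitude mult.assoc)
  qed (simp add: z_op_def x_op_def tensor_op_def)
qed

section \<open>Uniqueness of graph states\<close>

text \<open>The stabilizer at \<open>a\<close> ties the amplitude at \<open>insert a S\<close> to
  the one at \<open>S\<close> up to sign; induction leads down to \<open>{}\<close>. The factor
  \<open>c\<close> is chosen before \<open>\<phi>\<close>, so all graph states of \<open>H\<close>
  share it.\<close>

lemma graph_state_amplitude:
  assumes "finite E" "S \<subseteq> E"
  shows "\<exists>c. cmod c = 1 \<and> (\<forall>\<phi>. graph_state E H \<phi> \<longrightarrow> \<phi> S = c * \<phi> {})"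
proof -
  have "finite S" using assms finite_subset by blast
  then show ?thesis using assms(2)
  proof (induction S)
    case empty
    show ?case by (rule exI[of _ 1]) auto
  next
    case (insert a S)
    then obtain c where c: "cmod c = 1" "\<And>\<phi>. graph_state E H \<phi> \<Longrightarrow> \<phi> S = c * \<phi> {}"
      by auto
    define w :: complex where "w = (\<Prod>i\<in>E. if i \<in> {b \<in> E. {a, b} \<in> H} \<inter> S then - 1 else 1)"
    have "\<phi> (insert a S) = w * c * \<phi> {}" if "graph_state E H \<phi>" for \<phi>
    proof -
      have "\<phi> (insert a S) = x_op E {a} (z_op E {b \<in> E. {a, b} \<in> H} \<phi>) (insert a S)"
        using that insert.prems by (simp add: graph_state_def)
      also have "\<dots> = z_op E {b \<in> E. {a, b} \<in> H} \<phi> (sym_diff (insert a S) {a})"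
        using assms(1) insert.prems by (intro x_op_amplitude) auto
      also have "sym_diff (insert a S) {a} = S"
        using insert.hyps by auto
      also have "z_op E {b \<in> E. {a, b} \<in> H} \<phi> S = w * \<phi> S"
        unfolding w_def using insert.prems by (intro z_op_amplitude[OF assms(1)]) auto
      finally show ?thesis using c(2)[OF that] by simp
    qed
    moreover have "cmod (w * c) = 1"
      using c(1) by (simp add: w_def norm_mult prod_norm[symmetric] prod.neutral)
    ultimately show ?case by blast
  qed
qed

text \<open>A graph state is determined by its amplitude at \<open>{}\<close>. All amplitudes have
  the same modulus, which the unit norm fixes and keeps away from 0, so the ratio of two amplitudes
  at \<open>{}\<close> is a phase.\<close>

lemma graph_state_unique:
  assumes "finite E" "graph_state E H \<phi>" "graph_state E H \<phi>'"
  shows "\<exists>c. cmod c = 1 \<and> \<phi> = (\<lambda>S. c * \<phi>' S)"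
proof -
  have "\<exists>\<sigma>. \<forall>S \<in> Pow E. cmod (\<sigma> S) = 1 \<and> (\<forall>\<phi>. graph_state E H \<phi> \<longrightarrow> \<phi> S = \<sigma> S * \<phi> {})"
    using graph_state_amplitude[OF assms(1)] by (intro bchoice) auto
  then obtain \<sigma> where
    "\<forall>S \<in> Pow E. cmod (\<sigma> S) = 1 \<and> (\<forall>\<phi>. graph_state E H \<phi> \<longrightarrow> \<phi> S = \<sigma> S * \<phi> {})"
    by blast
  then have \<sigma>: "cmod (\<sigma> S) = 1" "\<And>\<phi>. graph_state E H \<phi> \<Longrightarrow> \<phi> S = \<sigma> S * \<phi> {}"
    if "S \<subseteq> E" for S
    using that by auto
  have norm: "card (Pow E) * (cmod (\<omega> {}))\<^sup>2 = 1" if "graph_state E H \<omega>" for \<omega>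
  proof -
    have "cmod (\<omega> S) = cmod (\<omega> {})" if "S \<in> Pow E" for S
    proof -
      have "cmod (\<omega> S) = cmod (\<sigma> S * \<omega> {})"
        using that by (intro arg_cong[where f = cmod] \<sigma>(2) \<open>graph_state E H \<omega>\<close>) auto
      then show ?thesis using \<sigma>(1)[of S] that by (simp add: norm_mult)
    qed
    then have "(\<Sum>S\<in>Pow E. (cmod (\<omega> S))\<^sup>2) = (\<Sum>S\<in>Pow E. (cmod (\<omega> {}))\<^sup>2)"
      by (intro sum.cong refl) (simp only:)
    then show ?thesis
      using that by (simp only: graph_state_def unit_qvec_def sum_constant)
  qed
  have ne: "\<phi>' {} \<noteq> 0" using norm[OF assms(3)] by auto
  have "(cmod (\<phi> {}))\<^sup>2 = (cmod (\<phi>' {}))\<^sup>2"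
    using norm[OF assms(2)] norm[OF assms(3)]
    by (metis mult_left_cancel mult_zero_left zero_neq_one)
  then have "cmod (\<phi> {} / \<phi>' {}) = 1"
    using ne by (simp add: norm_divide)
  moreover have "\<phi> S = \<phi> {} / \<phi>' {} * \<phi>' S" for S
  proof (cases "S \<subseteq> E")
    case True
    have "\<phi> S * \<phi>' {} = (\<sigma> S * \<phi> {}) * \<phi>' {}"
      by (rule arg_cong2[where f = times, OF \<sigma>(2)[OF True assms(2)] refl])
    also have "\<dots> = \<phi> {} * (\<sigma> S * \<phi>' {})"
      by (simp only: ac_simps)
    also have "\<sigma> S * \<phi>' {} = \<phi>' S"
      by (rule \<sigma>(2)[OF True assms(3), symmetric])
    finally show ?thesis
      by (simp only: times_divide_eq_left nonzero_eq_divide_eq[OF ne])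
  next
    case False
    then show ?thesis using assms(2,3) by (simp add: graph_state_def unit_qvec_def)
  qed
  ultimately show ?thesis
    by (intro exI[of _ "\<phi> {} / \<phi>' {}"] conjI ext)
qed

section \<open>Hadamard gates and Clifford gates\<close>

definition hadamard :: gate where
  "hadamard = (\<chi> a b. (if a \<and> b then - 1 else 1) / sqrt 2)"

lemma sqrt_2_mult_self: "complex_of_real (sqrt 2) * complex_of_real (sqrt 2) = 2"
  by (simp flip: of_real_mult)

lemma hadamard_involution: "hadamard ** hadamard = mat 1"
  by (simp add: gate_eq_iff gate_mult_entry hadamard_def mat_def sqrt_2_mult_self)

lemma hadamard_pauli_x: "hadamard ** pauli_x = pauli_z ** hadamard"
  and hadamard_pauli_z: "hadamard ** pauli_z = pauli_x ** hadamard"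
  by (simp_all add: gate_eq_iff gate_mult_entry hadamard_def pauli_x_def pauli_z_def)

text \<open>Conjugation by \<open>hadamard\<close> negates \<open>pauli_y\<close>. The sign is
  written as conjugation by \<open>pauli_x\<close>, so that the result is visibly a product of
  generators of \<open>pauli_group\<close>.\<close>

lemma hadamard_pauli_y: "hadamard ** pauli_y = (pauli_x ** pauli_y ** pauli_x) ** hadamard"
  by (simp add: gate_eq_iff gate_mult_entry hadamard_def pauli_x_def pauli_y_def)

section \<open>Membership in the single-qubit Clifford group\<close>

lemma matrix_conj_mult:
  fixes U V P Q :: "'a::semiring_1^'n^'n"
  assumes "V ** U = mat 1"
  shows "U ** (P ** Q) ** V = (U ** P ** V) ** (U ** Q ** V)"
  by (metis assms matrix_mul_assoc matrix_mul_lid)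

text \<open>Conjugation by a self-adjoint involution is its own inverse, so it maps onto
  \<open>pauli_group\<close> as soon as it maps the generators into it.\<close>

lemma clifford_groupI:
  assumes "adjoint_gate U = U" "U ** U = mat 1"
    and "U ** pauli_x ** U \<in> pauli_group" "U ** pauli_y ** U \<in> pauli_group"
      "U ** pauli_z ** U \<in> pauli_group"
  shows "U \<in> clifford_group"
proof -
  have 1: "U ** P ** U \<in> pauli_group" if "P \<in> pauli_group" for P
    using that
  proof induction
    case one
    then show ?case using assms(2) by (simp add: pauli_group.one)
  next
    case (mult P Q)
    then show ?case by (simp add: matrix_conj_mult[OF assms(2)] pauli_group.mult)
  qed (use assms in auto)
  have "P \<in> (\<lambda>P. U ** P ** U) ` pauli_group" if "P \<in> pauli_group" for P
  proof
    show "P = U ** (U ** P ** U) ** U"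
      by (metis assms(2) matrix_mul_assoc matrix_mul_lid matrix_mul_rid)
  qed (use 1 that in auto)
  then show ?thesis
    using 1 assms by (auto simp: clifford_group_def)
qed

lemma adjoint_gate_mult: "adjoint_gate (U ** V) = adjoint_gate V ** adjoint_gate U"
  by (auto simp: adjoint_gate_def matrix_matrix_mult_def vec_eq_iff mult.commute)

lemma clifford_group_mult:
  assumes "U \<in> clifford_group" "V \<in> clifford_group"
  shows "U ** V \<in> clifford_group"
proof -
  have "(\<lambda>P. (U ** V) ** P ** adjoint_gate (U ** V)) =
      (\<lambda>P. U ** P ** adjoint_gate U) \<circ> (\<lambda>P. V ** P ** adjoint_gate V)"
    by (simp add: fun_eq_iff adjoint_gate_mult matrix_mul_assoc)
  then have "(\<lambda>P. (U ** V) ** P ** adjoint_gate (U ** V)) ` pauli_group = pauli_group"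
    using assms by (simp only: image_comp[symmetric]) (simp add: clifford_group_def)
  moreover have "U ** V ** adjoint_gate (U ** V) = U ** (V ** adjoint_gate V) ** adjoint_gate U"
    "adjoint_gate (U ** V) ** (U ** V) = adjoint_gate V ** (adjoint_gate U ** U) ** V"
    by (simp_all add: adjoint_gate_mult matrix_mul_assoc)
  ultimately show ?thesis using assms by (simp add: clifford_group_def)
qed

lemma adjoint_gate_one: "adjoint_gate (mat 1) = mat 1"
  by (auto simp: adjoint_gate_def mat_def vec_eq_iff)

lemma one_in_clifford_group: "mat 1 \<in> clifford_group"
  by (rule clifford_groupI) (auto simp: adjoint_gate_one intro: pauli_group.intros)

lemma pauli_x_in_clifford_group: "pauli_x \<in> clifford_group"
  by (rule clifford_groupI)
    (simp_all add: pauli_x_involution pauli_group.intros, simp add: adjoint_gate_def pauli_x_def vec_eq_iff)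

lemma hadamard_in_clifford_group: "hadamard \<in> clifford_group"
proof (rule clifford_groupI)
  show "adjoint_gate hadamard = hadamard"
    by (auto simp: adjoint_gate_def hadamard_def vec_eq_iff)
qed (auto simp: hadamard_involution hadamard_pauli_x hadamard_pauli_y hadamard_pauli_z
    matrix_mul_assoc[symmetric] intro!: pauli_group.intros)

text \<open>The hypotheses make \<open>H\<close> bipartite with parts \<open>T\<close> and
  \<open>E - T\<close>. Hadamard gates on \<open>E - T\<close> turn each cut operator into the graph
  stabilizer at a vertex of \<open>T\<close>, and each cycle operator into the one at a vertex of
  \<open>E - T\<close>.\<close>

lemma graph_state_hadamard:
  assumes "finite E" "unit_qvec E \<psi>" "T \<subseteq> E"
    and "\<And>f. f \<in> E - T \<Longrightarrow> P f \<subseteq> T"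
    and cycles: "\<And>f. f \<in> E - T \<Longrightarrow> z_op E (insert f (P f)) \<psi> = \<psi>"
    and cuts: "\<And>e. e \<in> T \<Longrightarrow> x_op E (insert e {f \<in> E - T. e \<in> P f}) \<psi> = \<psi>"
    and H_tree: "\<And>e. e \<in> T \<Longrightarrow> {b \<in> E. {e, b} \<in> H} = {f \<in> E - T. e \<in> P f}"
    and H_cotree: "\<And>f. f \<in> E - T \<Longrightarrow> {b \<in> E. {f, b} \<in> H} = P f"
  shows "graph_state E H (tensor_op E (\<lambda>i. if i \<in> T then mat 1 else hadamard) \<psi>)"
proof -
  let ?U = "\<lambda>i. if i \<in> T then mat 1 else hadamard"
  have "adjoint_gate (?U i) ** ?U i = mat 1" for i
    using one_in_clifford_group hadamard_in_clifford_group by (auto simp: clifford_group_def)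
  then have "unit_qvec E (tensor_op E ?U \<psi>)"
    by (intro unit_qvec_tensor_op assms)
  moreover have "x_op E {a} (z_op E {b \<in> E. {a, b} \<in> H} (tensor_op E ?U \<psi>)) = tensor_op E ?U \<psi>"
    if "a \<in> E" for a
  proof (cases "a \<in> T")
    case True
    \<comment> \<open>All neighbours of \<open>a\<close> lie outside \<open>T\<close>, where
      \<open>pauli_z ** hadamard = hadamard ** pauli_x\<close>.\<close>
    have "x_op E {a} (z_op E {b \<in> E. {a, b} \<in> H} (tensor_op E ?U \<psi>)) =
        tensor_op E ?U (x_op E (insert a {f \<in> E - T. a \<in> P f}) \<psi>)"
      unfolding x_op_def z_op_def H_tree[OF True] tensor_op_compose[OF assms(1)]
      using True by (intro tensor_op_cong) (auto simp: hadamard_pauli_x)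
    then show ?thesis
      by (simp only: cuts[OF True])
  next
    case False
    with that have a: "a \<in> E - T" by simp
    \<comment> \<open>Here \<open>a\<close> itself carries the Hadamard gate, while its neighbours
      lie in \<open>T\<close> and keep \<open>pauli_z\<close>.\<close>
    have "x_op E {a} (z_op E {b \<in> E. {a, b} \<in> H} (tensor_op E ?U \<psi>)) =
        tensor_op E ?U (z_op E (insert a (P a)) \<psi>)"
      unfolding x_op_def z_op_def H_cotree[OF a] tensor_op_compose[OF assms(1)]
      using a assms(4)[OF a] by (intro tensor_op_cong) (auto simp: hadamard_pauli_z)
    then show ?thesis
      by (simp only: cycles[OF a])
  qed
  ultimately show ?thesis
    by (simp add: graph_state_def)
qed

section \<open>Boundaries of edge sets and simple cycles\<close>

lemma mem_sum_mod2: "x \<in> sum_mod2 I A \<longleftrightarrow> odd (card {i \<in> I. x \<in> A i})"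
  by (simp add: sum_mod2_def)

lemma sum_mod2_empty [simp]: "sum_mod2 {} A = {}"
  by (simp add: sum_mod2_def)

lemma sum_mod2_insert:
  assumes "finite I" "i \<notin> I"
  shows "sum_mod2 (insert i I) A = sym_diff (A i) (sum_mod2 I A)"
proof (rule Set.set_eqI)
  fix x
  have "{j \<in> insert i I. x \<in> A j} =
      (if x \<in> A i then insert i {j \<in> I. x \<in> A j} else {j \<in> I. x \<in> A j})"
    by auto
  then show "x \<in> sum_mod2 (insert i I) A \<longleftrightarrow> x \<in> sym_diff (A i) (sum_mod2 I A)"
    using assms by (simp add: mem_sum_mod2)
qed

text \<open>Indices in \<open>I \<inter> J\<close> are counted twice and drop out mod 2.\<close>

lemma sum_mod2_sym_diff:
  assumes "finite I" "finite J"
  shows "sum_mod2 (sym_diff I J) A = sym_diff (sum_mod2 I A) (sum_mod2 J A)"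
proof (rule Set.set_eqI)
  fix x
  let ?c = "\<lambda>I. {i \<in> I. x \<in> A i}"
  have "card (?c (I - J)) + card (?c (I \<inter> J)) = card (?c I)"
    using assms by (subst card_Un_disjoint[symmetric]) (auto intro!: arg_cong[where f = card])
  moreover have "card (?c (J - I)) + card (?c (I \<inter> J)) = card (?c J)"
    using assms by (subst card_Un_disjoint[symmetric]) (auto intro!: arg_cong[where f = card])
  moreover have "card (?c (I - J)) + card (?c (J - I)) = card (?c (sym_diff I J))"
    using assms by (subst card_Un_disjoint[symmetric]) (auto intro!: arg_cong[where f = card])
  ultimately show "x \<in> sum_mod2 (sym_diff I J) A \<longleftrightarrow> x \<in> sym_diff (sum_mod2 I A) (sum_mod2 J A)"
    by (simp add: mem_sum_mod2) presburger
qed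

text \<open>Serves to pass from generating chains to their sums, for properties of the Pauli
  operators attached to edge sets.\<close>

lemma sum_mod2_closed:
  assumes "finite I" "P {}" "\<And>i. i \<in> I \<Longrightarrow> P (A i)"
    and "\<And>D D'. P D \<Longrightarrow> P D' \<Longrightarrow> P (sym_diff D D')"
  shows "P (sum_mod2 I A)"
  using assms(1,3)
proof (induction I)
  case (insert i I)
  then have "P (sym_diff (A i) (sum_mod2 I A))"
    by (intro assms(4)) auto
  then show ?case
    by (simp only: sum_mod2_insert[OF insert.hyps])
qed (simp add: assms(2))

text \<open>Applied to \<open>ends L\<close>, \<open>sum_mod2\<close> is the mod 2 boundary map; the
  inner vertices of a path are met twice and cancel. The form \<open>sym_diff {p} {q}\<close> also
  covers the trivial path, whose boundary is empty.\<close>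

lemma graph_path_sum_mod2:
  assumes "graph_path L p xs es q"
  shows "sum_mod2 (set es) (ends L) = sym_diff {p} {q}"
  using assms
proof (induction es arbitrary: p xs)
  case Nil
  then show ?case by (auto simp: graph_path_def length_Suc_conv)
next
  case (Cons e es)
  then obtain x xs' where xs: "xs = p # x # xs'"
    by (auto simp: graph_path_def length_Suc_conv)
  have e: "ends L e = {p, x}" "p \<noteq> x"
    using Cons.prems by (auto simp: graph_path_def xs)
  have *: "ends L (es ! i) = {(x # xs') ! i, (x # xs') ! Suc i}" if "i < length es" for i
    using Cons.prems that unfolding graph_path_def xs by (auto dest!: spec[of _ "Suc i"])
  then have path: "graph_path L x (x # xs') es q"
    using Cons.prems unfolding graph_path_def xs by auto
  \<comment> \<open>The vertices of the path are distinct, so no later edge returns to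
    \<open>p\<close>; hence \<open>e\<close> does not occur again and contributes exactly
    once.\<close>
  have "p \<notin> ends L f" if f: "f \<in> set es" for f
  proof -
    obtain i where i: "i < length es" "f = es ! i"
      using f by (auto simp: in_set_conv_nth)
    moreover have "(x # xs') ! i \<in> set (x # xs')" "(x # xs') ! Suc i \<in> set (x # xs')"
      using i path unfolding graph_path_def by (intro nth_mem; simp)+
    ultimately have "ends L f \<subseteq> set (x # xs')"
      using *[of i] by auto
    then show ?thesis
      using Cons.prems unfolding graph_path_def xs by auto
  qed
  then have "e \<notin> set es" using e by auto
  then show ?case
    using Cons.IH[OF path] e by (auto simp: sum_mod2_insert)
qed

section \<open>Simple cycles in edge sets with even degrees\<close>

text \<open>An edge determines its pair of consecutive path vertices, and a pair of consecutive
  vertices occurs at only one position because the vertices are distinct.\<close>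

lemma graph_path_distinct_edges:
  assumes "graph_path L p xs es q"
  shows "distinct es"
proof -
  have "i = j" if "i < length es" "j < length es" "es ! i = es ! j" for i j
  proof -
    have "{xs ! i, xs ! Suc i} = {xs ! j, xs ! Suc j}" "distinct xs" "length xs = Suc (length es)"
      using assms that by (auto simp: graph_path_def) (metis insert_iff singletonD)+
    then show ?thesis
      using that by (auto simp: doubleton_eq_iff nth_eq_iff_index_eq)
  qed
  then show ?thesis by (auto simp: distinct_conv_nth)
qed

text \<open>A second edge of \<open>D\<close> at the start of a path of maximal length must lead back to a vertex
  of the path, which closes a simple cycle.\<close>

lemma cycle_contains_simple_cycle:
  assumes "finite (verts L)" "\<And>e. e \<in> edges L \<Longrightarrow> ends L e \<subseteq> verts L \<and> card (ends L e) = 2"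
    and "finite D" "cycle L D" "D \<noteq> {}"
  shows "\<exists>D'. simple_cycle L D'"
proof -
  define P where "P = (\<lambda>n. \<exists>p xs es q. graph_path L p xs es q \<and> set es \<subseteq> D \<and> length es = n)"
  obtain e where e: "e \<in> D" using assms by auto
  have D: "D \<subseteq> edges L" using assms(4) by (simp add: cycle_def)
  obtain p q where pq: "ends L e = {p, q}" "p \<noteq> q"
    using assms(2)[of e] e D by (meson card_2_iff subsetD)
  have "graph_path L p [p, q] [e] q"
    using pq assms(2)[of e] e D by (auto simp: graph_path_def)
  then have P1: "P 1" unfolding P_def using e by (intro exI[of _ p] exI[of _ "[p, q]"] exI[of _ "[e]"] exI[of _ q]) auto
  \<comment> \<open>A path with \<open>n\<close> edges visits \<open>n + 1\<close> distinct
    vertices, so lengths are bounded and a longest path exists.\<close>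
  have bound: "n \<le> card (verts L)" if P: "P n" for n
  proof -
    obtain p xs es q where *: "graph_path L p xs es q" "length es = n"
      using P by (auto simp: P_def)
    then have "card (set xs) = Suc n" "set xs \<subseteq> verts L"
      by (simp_all add: graph_path_def distinct_card)
    then show ?thesis using card_mono[OF assms(1), of "set xs"] by linarith
  qed
  define n where "n = Greatest P"
  have "P n" unfolding n_def using P1 bound by (rule GreatestI_nat)
  moreover have "1 \<le> n" unfolding n_def using P1 bound by (rule Greatest_le_nat)
  ultimately obtain x xs es' q where
    es': "graph_path L x xs es' q" "set es' \<subseteq> D" "length es' = n" "es' \<noteq> []"
    unfolding P_def by (metis list.size(3) not_one_le_zero)
  then obtain f es where "es' = f # es"
    by (cases es') auto
  with es' have path: "graph_path L x xs (f # es) q" and sub: "set (f # es) \<subseteq> D"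
    and len: "Suc (length es) = n"
    by auto
  have xs: "length xs = Suc n" "distinct xs" "set xs \<subseteq> verts L" "xs ! 0 = x" "x \<in> verts L"
    and ends: "\<And>i. i < n \<Longrightarrow> ends L ((f # es) ! i) = {xs ! i, xs ! Suc i}"
    using path len by (cases xs; simp add: graph_path_def)+
  have f: "x \<in> ends L f" "f \<in> D"
    using ends[of 0] len xs sub by auto
  have "even (card {e \<in> D. x \<in> ends L e})"
    using assms(4) xs by (auto simp: cycle_def)
  then have "{e \<in> D. x \<in> ends L e} \<noteq> {f}"
    by auto
  then obtain f' where f': "f' \<in> D" "x \<in> ends L f'" "f' \<noteq> f"
    using f by auto
  obtain y where y: "ends L f' = {y, x}" "y \<noteq> x"
    using assms(2)[of f'] f' D by (fastforce simp: card_2_iff)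
  have "y \<in> set xs"
  proof (rule ccontr)
    assume "y \<notin> set xs"
    then have "graph_path L y (y # xs) (f' # f # es) q"
      using path y f' D assms(2)[of f'] xs
      by (auto simp: graph_path_def nth_Cons split: nat.splits)
    then have "P (Suc n)"
      unfolding P_def using sub f' len by (intro exI conjI) auto
    then show False
      using Greatest_le_nat[of P "Suc n", OF _ bound] by (simp add: n_def)
  qed
  then obtain j where j: "j \<le> n" "xs ! j = y"
    using xs by (auto simp: in_set_conv_nth less_Suc_eq_le)
  then have "0 < j" using y xs by (cases j) auto
  \<comment> \<open>As \<open>x\<close> is the first vertex of the path, the only path edge at
    \<open>x\<close> is \<open>f\<close>.\<close>
  have f'_notin: "f' \<notin> set (f # es)"
  proof
    assume "f' \<in> set (f # es)"
    then obtain i where i: "i < n" "f' = (f # es) ! i"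
      using len by (auto simp: in_set_conv_nth simp del: set_simps)
    then have "xs ! 0 \<in> {xs ! i, xs ! Suc i}" using ends[of i] f' xs by simp
    then have "i = 0" using xs i by (auto simp: nth_eq_iff_index_eq)
    then show False using i f' by simp
  qed
  \<comment> \<open>The first \<open>j\<close> path edges run from \<open>x\<close> to
    \<open>y\<close>, and \<open>f'\<close> leads back. For \<open>j = 1\<close> this is the pair of
    parallel edges \<open>f\<close> and \<open>f'\<close>.\<close>
  define cs where "cs = take j (f # es) @ [f']"
  have "length cs = Suc j" using j len by (simp add: cs_def)
  moreover have "distinct cs"
    using distinct_take[OF graph_path_distinct_edges[OF path], of j] f'_notin
      set_take_subset[of j "f # es"]
    by (auto simp: cs_def)
  moreover have "ends L (cs ! i) = {take (Suc j) xs ! i, take (Suc j) xs ! (Suc i mod Suc j)}"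
    if "i < Suc j" for i
  proof (cases "i = j")
    case True
    then show ?thesis using y j xs len by (auto simp: cs_def nth_append)
  next
    case False
    then show ?thesis using that ends[of i] j len by (auto simp: cs_def nth_append)
  qed
  moreover have "set cs \<subseteq> edges L"
    using order_trans[OF sub D] subsetD[OF D f'(1)] set_take_subset[of j "f # es"]
    unfolding cs_def set_append by (metis Un_least empty_set insert_subset list.simps(15)
        order_trans empty_subsetI)
  ultimately have "simple_cycle L (set cs)"
    unfolding simple_cycle_def using xs j
    by (intro conjI exI[of _ "take (Suc j) xs"] exI[of _ cs]) (auto dest: in_set_takeD simp del: take_Suc)
  then show ?thesis ..
qed

section \<open>Fundamental cycles and cuts of a spanning tree\<close>

lemma spanning_tree_multigraph:
  assumes "multigraph L" "spanning_tree T L"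
  shows "multigraph T"
  using assms unfolding multigraph_def spanning_tree_def by (metis finite_subset subsetD)

text \<open>Two edge sets with the same boundary differ by a cycle, and a nonempty cycle would yield
  a simple cycle.\<close>

lemma acyclic_boundary_inj:
  assumes "multigraph T" "\<nexists>D. simple_cycle T D" "D \<subseteq> edges T" "D' \<subseteq> edges T"
    and "sum_mod2 D (ends T) = sum_mod2 D' (ends T)"
  shows "D = D'"
proof (rule ccontr)
  assume "D \<noteq> D'"
  have fin: "finite D" "finite D'"
    using assms(1,3,4) by (auto simp: multigraph_def intro: finite_subset)
  then have "sum_mod2 (sym_diff D D') (ends T) = {}"
    using assms(5) by (subst sum_mod2_sym_diff) auto
  then have "cycle T (sym_diff D D')"
    using assms(3,4) by (auto simp: cycle_def sum_mod2_def)
  then show False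
    using cycle_contains_simple_cycle[of T "sym_diff D D'"] assms(1,2) fin \<open>D \<noteq> D'\<close>
    by (auto simp: multigraph_def)
qed

text \<open>Junk value if \<^term>\<open>W\<close> is not the boundary of a unique set of tree edges.\<close>

definition tree_join :: "('v, 'e) multigraph \<Rightarrow> 'v set \<Rightarrow> 'e set" where
  "tree_join T W = (THE D. D \<subseteq> edges T \<and> sum_mod2 D (ends T) = W)"

lemma tree_join_eqI:
  assumes "multigraph L" "spanning_tree T L" "D \<subseteq> edges T" "sum_mod2 D (ends T) = W"
  shows "tree_join T W = D"
  unfolding tree_join_def
proof (rule the_equality)
  fix D' assume "D' \<subseteq> edges T \<and> sum_mod2 D' (ends T) = W"
  then show "D' = D"
    using acyclic_boundary_inj[of T D' D] spanning_tree_multigraph[OF assms(1,2)] assms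
    by (auto simp: spanning_tree_def)
qed (use assms in auto)

text \<open>The edges of a tree path from \<open>p\<close> to \<open>q\<close> have the required
  boundary. The case \<open>p = q\<close> is included because the cut construction joins a base
  vertex to every vertex, itself too.\<close>

lemma tree_join_vertices:
  assumes "multigraph L" "spanning_tree T L" "p \<in> verts L" "q \<in> verts L"
  shows "tree_join T (sym_diff {p} {q}) \<subseteq> edges T"
    and "sum_mod2 (tree_join T (sym_diff {p} {q})) (ends T) = sym_diff {p} {q}"
proof -
  obtain xs es where path: "graph_path T p xs es q"
    using assms unfolding spanning_tree_def connected_graph_def by metis
  have "set es \<subseteq> edges T" "sum_mod2 (set es) (ends T) = sym_diff {p} {q}"
    using path graph_path_sum_mod2[OF path] by (auto simp: graph_path_def)
  with tree_join_eqI[OF assms(1,2) this] show "tree_join T (sym_diff {p} {q}) \<subseteq> edges T"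
    "sum_mod2 (tree_join T (sym_diff {p} {q})) (ends T) = sym_diff {p} {q}"
    by simp_all
qed

lemma multigraph_ends:
  assumes "multigraph L" "e \<in> edges L"
  obtains p q where "p \<in> verts L" "q \<in> verts L" "p \<noteq> q" "ends L e = {p, q}" "ends L e = sym_diff {p} {q}"
proof -
  have "card (ends L e) = 2" "ends L e \<subseteq> verts L"
    using assms by (auto simp: multigraph_def)
  then obtain p q where "ends L e = {p, q}" "p \<noteq> q"
    by (meson card_2_iff)
  with that[of p q] \<open>ends L e \<subseteq> verts L\<close> show ?thesis
    by auto
qed

lemma tree_join_ends:
  assumes "multigraph L" "spanning_tree T L" "e \<in> edges L"
  shows "tree_join T (ends L e) \<subseteq> edges T"
    and "sum_mod2 (tree_join T (ends L e)) (ends T) = ends L e"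
proof -
  obtain p q where "p \<in> verts L" "q \<in> verts L" "ends L e = sym_diff {p} {q}"
    using multigraph_ends[OF assms(1,3)] by metis
  then show "tree_join T (ends L e) \<subseteq> edges T"
    "sum_mod2 (tree_join T (ends L e)) (ends T) = ends L e"
    using tree_join_vertices[OF assms(1,2), of p q] by simp_all
qed

text \<open>The edge alone already has the required boundary. Consequently two tree edges are never
  adjacent in the graph, and a fundamental cut contains just one tree edge.\<close>

lemma tree_join_tree_edge:
  assumes "multigraph L" "spanning_tree T L" "e \<in> edges T"
  shows "tree_join T (ends L e) = {e}"
proof (rule tree_join_eqI[OF assms(1,2)])
  show "sum_mod2 {e} (ends T) = ends L e"
    using assms sum_mod2_insert[of "{}" e "ends T"] by (simp add: spanning_tree_def)
qed (use assms in auto)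

text \<open>A tree path between the ends of \<open>r\<close> has boundary \<open>ends L r\<close>,
  so its edge set is the join. The disjunction reflects that the pair is unordered.\<close>

lemma phi_edges_iff:
  assumes "multigraph L" "spanning_tree T L"
  shows "{r, s} \<in> phi_edges T L \<longleftrightarrow> r \<in> edges L \<and> s \<in> edges L \<and> r \<noteq> s \<and>
    (s \<in> tree_join T (ends L r) \<or> r \<in> tree_join T (ends L s))"
proof -
  have "(\<exists>p q xs es. ends L r = {p, q} \<and> graph_path T p xs es q \<and> s \<in> set es) \<longleftrightarrow>
      s \<in> tree_join T (ends L r)" if r: "r \<in> edges L" for r s
  proof -
    have join: "tree_join T (ends L r) = set es" if "ends L r = {p, q}" "graph_path T p xs es q" for p q xs es
    proof (rule tree_join_eqI[OF assms])
      have "p \<noteq> q"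
        using that(1) r assms(1) by (auto simp: multigraph_def)
      then show "sum_mod2 (set es) (ends T) = ends L r"
        using graph_path_sum_mod2[OF that(2)] that(1) by auto
    qed (use that in \<open>auto simp: graph_path_def\<close>)
    obtain p q where "p \<in> verts L" "q \<in> verts L" "ends L r = {p, q}"
      using multigraph_ends[OF assms(1) r] by metis
    moreover from this obtain xs es where "graph_path T p xs es q"
      using assms unfolding spanning_tree_def connected_graph_def by metis
    ultimately show ?thesis
      using join by metis
  qed
  then have "phi_edges T L = {{r, s} | r s. r \<in> edges L \<and> s \<in> edges L \<and> r \<noteq> s \<and>
      s \<in> tree_join T (ends L r)}"
    unfolding phi_edges_def by (simp only: cong: conj_cong)
  then show ?thesis
    by (auto simp: doubleton_eq_iff)
qed

text \<open>The edge \<open>f\<close> and the tree path between its ends have the same mod 2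
  boundary, which cancels.\<close>

lemma fundamental_cycle:
  assumes "multigraph L" "spanning_tree T L" "f \<in> edges L - edges T"
  shows "cycle L (insert f (tree_join T (ends L f)))"
proof -
  let ?P = "tree_join T (ends L f)"
  have f: "f \<in> edges L" "f \<notin> ?P" and sub: "?P \<subseteq> edges T" "edges T \<subseteq> edges L"
    using tree_join_ends(1)[OF assms(1,2), of f] assms(2,3) by (auto simp: spanning_tree_def)
  have fin: "finite ?P"
    using sub assms(1) by (meson finite_subset multigraph_def)
  have "sum_mod2 ?P (ends L) = sum_mod2 ?P (ends T)"
    using sub assms(2) unfolding sum_mod2_def spanning_tree_def
    by (intro Collect_cong arg_cong[where f = "\<lambda>A. odd (card A)"]) auto
  then have "sum_mod2 (insert f ?P) (ends L) = {}"
    using tree_join_ends(2)[OF assms(1,2) f(1)] by (simp add: sum_mod2_insert[OF fin f(2)])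
  then show ?thesis
    using sub f by (auto simp: cycle_def sum_mod2_def)
qed

text \<open>For a tree edge \<open>e\<close>, the vertices whose tree path from \<open>a\<close>
  uses \<open>e\<close> form the side of the cut away from \<open>a\<close>. The sum of their stars
  counts an edge twice when both its ends lie there, so the edges crossing the cut remain.\<close>

lemma fundamental_cut:
  assumes "multigraph L" "spanning_tree T L" "a \<in> verts L"
  shows "sum_mod2 {x \<in> verts L. e \<in> tree_join T (sym_diff {a} {x})} (\<lambda>x. {f \<in> edges L. x \<in> ends L f}) =
    {f \<in> edges L. e \<in> tree_join T (ends L f)}" (is "sum_mod2 ?S ?star = _")
proof -
  have "f \<in> sum_mod2 ?S ?star \<longleftrightarrow> e \<in> tree_join T (ends L f)" if f: "f \<in> edges L" for f
  proof -
    obtain p q where pq: "p \<in> verts L" "q \<in> verts L" "p \<noteq> q" "ends L f = {p, q}"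
      "ends L f = sym_diff {p} {q}"
      by (rule multigraph_ends[OF assms(1) f])
    let ?J = "\<lambda>x. tree_join T (sym_diff {a} {x})"
    note J = tree_join_vertices[OF assms]
    have fin: "finite (?J x)" if "x \<in> verts L" for x
      using J(1)[OF that] spanning_tree_multigraph[OF assms(1,2)]
      by (auto simp: multigraph_def intro: finite_subset)
    \<comment> \<open>The paths from \<open>a\<close> to \<open>p\<close> and from \<open>a\<close>
      to \<open>q\<close> add up to a set with boundary \<open>{p, q}\<close>, which uniqueness
      identifies with the path from \<open>p\<close> to \<open>q\<close>.\<close>
    have "tree_join T (ends L f) = sym_diff (?J p) (?J q)"
    proof (rule tree_join_eqI[OF assms(1,2)])
      show "sym_diff (?J p) (?J q) \<subseteq> edges T"
        using J(1)[OF pq(1)] J(1)[OF pq(2)] by auto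
      show "sum_mod2 (sym_diff (?J p) (?J q)) (ends T) = ends L f"
        unfolding sum_mod2_sym_diff[OF fin[OF pq(1)] fin[OF pq(2)]] J(2)[OF pq(1)] J(2)[OF pq(2)] pq(5)
        by auto
    qed
    then have "e \<in> tree_join T (ends L f) \<longleftrightarrow> (p \<in> ?S) \<noteq> (q \<in> ?S)"
      using pq(1,2) by auto
    moreover have "{x \<in> ?S. f \<in> ?star x} = ?S \<inter> {p, q}"
      using f pq(4) by auto
    moreover have "odd (card (A \<inter> {p, q})) \<longleftrightarrow> (p \<in> A) \<noteq> (q \<in> A)" for A
      using pq(3) by (cases "p \<in> A"; cases "q \<in> A") (simp_all add: Int_insert_right)
    ultimately show ?thesis
      by (simp only: mem_sum_mod2)
  qed
  moreover have "sum_mod2 ?S ?star \<subseteq> edges L"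
  proof
    fix f assume "f \<in> sum_mod2 ?S ?star"
    then have "{x \<in> ?S. f \<in> ?star x} \<noteq> {}"
      unfolding mem_sum_mod2 by (metis card.empty even_zero)
    then show "f \<in> edges L" by auto
  qed
  ultimately show ?thesis by blast
qed

section \<open>Stabilizers of the surface code state\<close>

text \<open>The cut is a mod 2 sum of vertex stars, and every star operator fixes
  \<open>\<psi>\<close>.\<close>

lemma surface_code_state_cut:
  assumes "multigraph L" "spanning_tree T L" "surface_code_state L X pt crv n C v \<psi>" "e \<in> edges T"
  shows "x_op (edges L) {f \<in> edges L. e \<in> tree_join T (ends L f)} \<psi> = \<psi>"
proof -
  have fin: "finite (edges L)" "finite (verts L)" and "e \<in> edges L"
    using assms by (auto simp: multigraph_def spanning_tree_def)
  then obtain a where a: "a \<in> verts L"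
    using multigraph_ends[OF assms(1)] by metis
  have star: "x_op (edges L) {f \<in> edges L. s \<in> ends L f} \<psi> = \<psi>" if "s \<in> verts L" for s
    using assms(3) that by (simp add: surface_code_state_def)
  show ?thesis
    unfolding fundamental_cut[OF assms(1,2) a, of e, symmetric]
  proof (rule sum_mod2_closed)
    show "x_op (edges L) {} \<psi> = \<psi>"
      using assms(3) by (intro x_op_empty fin) (simp add: surface_code_state_def)
    show "x_op (edges L) (sym_diff D D') \<psi> = \<psi>"
      if "x_op (edges L) D \<psi> = \<psi>" "x_op (edges L) D' \<psi> = \<psi>" for D D'
      using that by (simp flip: x_op_sym_diff[OF fin(1)])
  qed (use fin star in auto)
qed

text \<open>Up to face boundaries, whose operators fix \<open>\<psi>\<close>, \<open>D\<close> is a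
  sum of basis cycles; each of these acts by a sign, and signs multiply.\<close>

lemma surface_code_state_cycle:
  assumes "multigraph L" "simple_homology_basis L X pt crv n C" "\<forall>k \<in> {1..n}. v k \<in> {- 1, 1}"
    and "surface_code_state L X pt crv n C v \<psi>" "cycle L D"
  shows "\<exists>c \<in> {- 1, 1}. z_op (edges L) D \<psi> = (\<lambda>S. c * \<psi> S)" (is "?Q D")
proof -
  have fin: "finite (edges L)" using assms by (simp add: multigraph_def)
  have diff: "?Q (sym_diff A B)" if "?Q A" "?Q B" for A B
  proof -
    from that(1) obtain c where c: "c \<in> {- 1, 1}" "z_op (edges L) A \<psi> = (\<lambda>S. c * \<psi> S)" ..
    from that(2) obtain d where d: "d \<in> {- 1, 1}" "z_op (edges L) B \<psi> = (\<lambda>S. d * \<psi> S)" ..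
    have "z_op (edges L) (sym_diff A B) \<psi> = z_op (edges L) A (\<lambda>S. d * \<psi> S)"
      by (simp only: z_op_sym_diff[OF fin, symmetric] d(2))
    also have "\<dots> = (\<lambda>S. d * z_op (edges L) A \<psi> S)"
      unfolding z_op_def by (rule tensor_op_scale)
    also have "\<dots> = (\<lambda>S. (d * c) * \<psi> S)"
      by (simp only: c(2) mult.assoc)
    finally show ?thesis
      using c(1) d(1) by (intro bexI[of _ "d * c"]) auto
  qed
  have empty: "?Q {}"
    using z_op_empty[OF fin, of \<psi>] assms(4) by (auto simp: surface_code_state_def)
  obtain K where K: "K \<subseteq> {1..n}" "homologous L X pt crv D (sum_mod2 K C)"
    using assms(2,5) unfolding simple_homology_basis_def by metis
  then obtain F where F: "finite F" "F \<subseteq> faces L X pt crv"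
    "sym_diff D (sum_mod2 K C) = sum_mod2 F (face_boundary L X pt crv)"
    unfolding homologous_def by metis
  have "?Q (sum_mod2 K C)"
  proof (rule sum_mod2_closed[of K ?Q])
    show "?Q (C k)" if "k \<in> K" for k
    proof (intro bexI)
      show "z_op (edges L) (C k) \<psi> = (\<lambda>S. of_int (v k) * \<psi> S)"
        using assms(4) K(1) that by (auto simp: surface_code_state_def)
      show "complex_of_int (v k) \<in> {- 1, 1}"
        using bspec[OF assms(3) subsetD[OF K(1) that]] by auto
    qed
  qed (use K finite_subset empty diff in auto)
  moreover have "?Q (sum_mod2 F (face_boundary L X pt crv))"
  proof (rule sum_mod2_closed[of F ?Q])
    show "?Q (face_boundary L X pt crv p)" if "p \<in> F" for p
      using assms(4) F(2) that by (intro bexI[of _ 1]) (auto simp: surface_code_state_def)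
  qed (use F empty diff in auto)
  \<comment> \<open>The face part is \<open>D\<close> plus the basis part, so adding the basis part
    again leaves \<open>D\<close>.\<close>
  ultimately have "?Q (sym_diff (sum_mod2 F (face_boundary L X pt crv)) (sum_mod2 K C))"
    by (intro diff)
  moreover have "sym_diff (sum_mod2 F (face_boundary L X pt crv)) (sum_mod2 K C) = D"
    unfolding F(3)[symmetric] by auto
  ultimately show ?thesis by simp
qed

section \<open>Sign correction and local Clifford equivalence with the graph state\<close>

theorem theorem1:
  fixes L L' :: "('v, 'e) multigraph"
    and X :: "'a topology" and g :: nat
    and pt :: "'v \<Rightarrow> 'a" and crv :: "'e \<Rightarrow> real \<Rightarrow> 'a"
    and C :: "nat \<Rightarrow> 'e set" and v :: "nat \<Rightarrow> int" and \<psi> :: "'e qvec"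
  assumes "multigraph L"
    and "closed_orientable_surface X g"
    and "two_cell_embedding L X pt crv"
    and "simple_homology_basis L X pt crv (2 * g) C"
    and "\<forall>k \<in> {1..2 * g}. v k \<in> {- 1, 1}"
    and "surface_code_state L X pt crv (2 * g) C v \<psi>"
    and "spanning_tree L' L"
  shows "(\<exists>\<phi>. graph_state (edges L) (phi_edges L' L) \<phi>) \<and>
    (\<forall>\<phi>. graph_state (edges L) (phi_edges L' L) \<phi> \<longrightarrow> lc_equivalent (edges L) \<phi> \<psi>)"
proof -
  let ?E = "edges L" and ?T = "edges L'" and ?H = "phi_edges L' L"
  define P where "P = (\<lambda>e. tree_join L' (ends L e))"
  \<comment> \<open>The eigenvalue of a fundamental cycle is a sign, so not fixing
    \<open>\<psi>\<close> means eigenvalue \<open>- 1\<close>.\<close>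
  define M where "M = {f \<in> ?E - ?T. z_op ?E (insert f (P f)) \<psi> \<noteq> \<psi>}"
  define U where "U = (\<lambda>i. if i \<in> ?T then mat 1 else hadamard)"
  define V where "V = (\<lambda>i. if i \<in> M then pauli_x else mat 1)"
  have fin: "finite ?E" and sub: "?T \<subseteq> ?E" and "M \<subseteq> ?E" and unit: "unit_qvec ?E \<psi>"
    using assms by (auto simp: multigraph_def spanning_tree_def M_def surface_code_state_def)
  have P: "P f \<subseteq> ?T" if "f \<in> ?E" for f
    unfolding P_def using tree_join_ends(1)[OF assms(1,7) that] .
  have P_tree: "P e = {e}" if "e \<in> ?T" for e
    unfolding P_def by (rule tree_join_tree_edge[OF assms(1,7) that])
  have phi: "{r, s} \<in> ?H \<longleftrightarrow> r \<in> ?E \<and> s \<in> ?E \<and> r \<noteq> s \<and> (s \<in> P r \<or> r \<in> P s)" for r s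
    unfolding P_def by (rule phi_edges_iff[OF assms(1,7)])
  have V: "V i \<in> clifford_group" for i
    by (simp add: V_def one_in_clifford_group pauli_x_in_clifford_group)
  have gs: "graph_state ?E ?H (tensor_op ?E U (x_op ?E M \<psi>))"
    unfolding U_def
  proof (rule graph_state_hadamard[where P = P])
    show "unit_qvec ?E (x_op ?E M \<psi>)"
      unfolding x_op_def V_def[symmetric]
      using V by (intro unit_qvec_tensor_op fin unit) (simp add: clifford_group_def)
    show "z_op ?E (insert f (P f)) (x_op ?E M \<psi>) = x_op ?E M \<psi>" if f: "f \<in> ?E - ?T" for f
    proof -
      let ?D = "insert f (P f)"
      obtain c where c: "c \<in> {- 1, 1}" "z_op ?E ?D \<psi> = (\<lambda>S. c * \<psi> S)"
        using surface_code_state_cycle[OF assms(1,4-6), of ?D] fundamental_cycle[OF assms(1,7) f]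
        unfolding P_def by blast
      \<comment> \<open>\<open>M\<close> avoids the tree and \<open>f\<close> is the only edge of
        its cycle outside the tree, so the cycles are corrected independently of each other.\<close>
      have "M \<inter> ?D = (if f \<in> M then {f} else {})"
        using P[of f] f by (auto simp: M_def)
      then have prod: "(\<Prod>i\<in>?E. if i \<in> M \<inter> ?D then - 1 else 1) = (if f \<in> M then - 1 else 1 :: complex)"
        using fin f by (simp add: prod.delta)
      \<comment> \<open>For \<open>f \<in> M\<close> the value of \<open>c\<close> is
        \<open>- 1\<close> and the extra sign cancels it; otherwise the cycle operator fixes
        \<open>\<psi>\<close> already.\<close>
      have "(\<lambda>S. (if f \<in> M then - 1 else 1) * (c * \<psi> S)) = \<psi>"
        using c f by (auto simp: M_def)
      then show ?thesis
        unfolding z_op_x_op[OF fin \<open>M \<subseteq> ?E\<close>] prod c(2)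
        by (simp only: x_op_def tensor_op_scale[symmetric])
    qed
    show "x_op ?E (insert e {f \<in> ?E - ?T. e \<in> P f}) (x_op ?E M \<psi>) = x_op ?E M \<psi>" if "e \<in> ?T" for e
    proof -
      \<comment> \<open>By \<open>P_tree\<close>, \<open>e\<close> is the only tree edge in its own
        cut.\<close>
      have "insert e {f \<in> ?E - ?T. e \<in> P f} = {f \<in> ?E. e \<in> P f}"
        using sub P_tree that by auto
      then show ?thesis
        using surface_code_state_cut[OF assms(1,7,6) that]
        by (simp only: x_op_commute[OF fin, of _ M] P_def)
    qed
    show "{b \<in> ?E. {e, b} \<in> ?H} = {f \<in> ?E - ?T. e \<in> P f}" if "e \<in> ?T" for e
      using that sub P_tree by (auto simp: phi)
    \<comment> \<open>All joins consist of tree edges, so two edges outside the tree are never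
      adjacent.\<close>
    show "{b \<in> ?E. {f, b} \<in> ?H} = P f" if "f \<in> ?E - ?T" for f
      using that sub P P_tree by (auto simp: phi)
  qed (use fin sub P in auto)
  moreover have "lc_equivalent ?E \<phi> \<psi>" if \<phi>: "graph_state ?E ?H \<phi>" for \<phi>
  proof -
    \<comment> \<open>Any graph state of \<open>?H\<close> differs from the constructed one only by
      a phase, which \<open>lc_equivalent\<close> allows.\<close>
    obtain c where "cmod c = 1" "\<phi> = (\<lambda>S. c * tensor_op ?E U (x_op ?E M \<psi>) S)"
      using graph_state_unique[OF fin \<phi> gs] by blast
    moreover have "tensor_op ?E U (x_op ?E M \<psi>) = tensor_op ?E (\<lambda>i. U i ** V i) \<psi>"
      unfolding x_op_def V_def[symmetric] by (rule tensor_op_compose[OF fin])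
    moreover have "U i ** V i \<in> clifford_group" for i
      using V by (intro clifford_group_mult)
        (auto simp: U_def one_in_clifford_group hadamard_in_clifford_group)
    ultimately show ?thesis
      unfolding lc_equivalent_def
      by (intro exI[of _ "\<lambda>i. U i ** V i"] exI[of _ c]) simp
  qed
  ultimately show ?thesis by blast
qed

end
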